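(* Let $\vec U$ be a finite universe of separations with an injective and structurally submodular order function $s\mapsto|s|$ on $U$. Let $k\in\mathbb R$ and $\vec S:=\vec U_k=\{\vec s\in\vec U:|s|<k\}$. Let $\mathcal F$ be a set that is rich and standard for $\vec S$ and includes $\mathcal R(\vec U)$. Let $(T,r,\beta)$ be a thoroughly ordered $\mathcal F$-tangle structure tree of $\vec S$, and let $N$ be the set of all separations $s_v\in S$ with $v$ a tangle node of $T$. Then $N$ is a tree of the $\mathcal F$-tangles of $S$; in particular, $N$ is nested. Moreover, $N$ consists of exactly those separations in $S$ that distinguish two $\mathcal F$-tangles of $S$ optimally.
   Context: A universe of separations is a set $\vec U$ with a partial order $\le$ making it a lattice (supremum $\vee$, infimum $\wedge$) and an order-reversing involution $\vec s\mapsto\vec s^{\,*}=:\overleftarrow s$; $U=\{\{\vec s,\overleftarrow s\}\}$. An order function $s\mapsto|s|$ on $U$ is extended by $|\vec s|=|\overleftarrow s|=|s|$; it is structurally submodular if for all $\vec r,\vec s\in\vec U$, $|\vec r\vee\vec s|\le|\vec r|$ or $|\vec r\wedge\vec s|\le|\vec s|$. $\vec S=\vec U_k$ inherits order and involution; $S$ is its set of unoriented separations. $\vec s$ is degenerate if $\vec s=\overleftarrow s$; $\vec s$ is trivial in $\vec S$ if some $t\in S$ has $\vec t<\vec s$ and $\overleftarrow t<\vec s$. Two separations are nested if they have comparable orientations; a set is nested if pairwise nested. A set $\sigma\subseteq\vec S$ is consistent if there are no $\vec r,\vec s\in\sigma$ with $r\ne s$ and $\vec r<\overleftarrow s$. Closure: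 $\lfloor\sigma\rfloor=\sigma\cup\{\vec s\in\vec S:\exists\vec r\in\sigma,\ r\ne s,\ \vec r<\vec s\}$. An $\mathcal F$-tangle of $S$ is a consistent orientation of $S$ (exactly one orientation of each $s\in S$) no subset of which lies in $\mathcal F$. A separation $s$ distinguishes two orientations $\tau,\tau'$ if they contain different orientations of $s$; it distinguishes them optimally if moreover no separation in $S$ of lower order distinguishes them. A tree of the ($\mathcal F$-)tangles of $S$ is a nested set $N\subseteq S$ such that every two distinct $\mathcal F$-tangles of $S$ are distinguished optimally by some separation in $N$. $\mathcal R(\vec U):=\{\{\vec r,\overleftarrow r\vee\vec s,\overleftarrow r\vee\overleftarrow s\}\subseteq\vec U: r,s\in U,\ |\overleftarrow r\vee\vec s|,|\overleftarrow r\vee\overleftarrow s|<|r|\}$. $\mathcal F$ is standard for $\vec S$ if $\{\overleftarrow s\}\in\mathcal F$ for every trivial $\vec s\in\vec S$. $\vec s$ is weakly eclipsed by $\vec r$ if $\vec r<\vec s$ and $|r|\le|s|$. A subset $\sigma\subseteq\tau$ is strongly efficient in $\tau$ if no element of $\sigma$ is weakly eclipsed by another element of $\tau$. $\mathcal F$ is rich for $\vec S$ if every consistent orientation of $S$ with a subset in $\mathcal F$ has a strongly efficient subset in $\mathcal F$. Separation trees: a rooted tree $(T,r)$ with tree order $\le_r$ (root minimal), leaves = maximal nodes, $E_v$ = edges from $v$ to its children, and $\beta\colon E(T)\to\vec S$ such that for each non-leaf $v$ there is $s_v\in S$ with $\beta$ a bijection $E_v\to\{\vec{s_v},\overleftarrow{s_v}\}$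 and $s_u\ne s_v$ whenever $u<_r v$; $\beta_v:=\beta(E(rTv))$. A leaf $\ell$ is a tangle leaf if $\lfloor\beta_\ell\rfloor$ is an $\mathcal F$-tangle of $S$, forbidden if $\beta_\ell$ has a subset in $\mathcal F$. An $\mathcal F$-tangle structure tree of $\vec S$ is a separation tree with all $\beta_v$ consistent, every leaf a tangle leaf or forbidden, and $\beta_v$ having no subset in $\mathcal F$ for every non-leaf $v$. It is thoroughly ordered if for every non-leaf $v$, neither orientation of $s_v$ lies in $\lfloor\beta_v\rfloor$ and $s_v$ has minimum order among separations in $S$ with no orientation in $\lfloor\beta_v\rfloor$. A non-leaf node $v$ is a tangle node if for every child $w$ of $v$ there is a tangle leaf $\ell\ge_r w$. (Under the hypotheses, such a thoroughly ordered tree exists and is unique.)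
   Formalization: The final equality is stated for the non-degenerate members of N only: a degenerate separation s_v has a single child edge, so v can be a tangle node although s_v distinguishes no tangles (e.g. U={d}, d=d*, F empty). N being a nested tree of tangles is stated for all of N. *)

theory Defs
  imports Complex_Main
begin

section \<open>Universes of separations\<close>

text \<open>
  The oriented separations are the elements of a lattice type, with the involution \<open>star\<close>.
  The unoriented separation underlying \<open>x\<close> is the set \<open>{x, star x}\<close>, and the orientations of an
  unoriented separation are its elements.
\<close>

definition universe :: "('a::lattice \<Rightarrow> 'a) \<Rightarrow> bool" where
  "universe star \<longleftrightarrow> (\<forall>x. star (star x) = x) \<and> antimono star"

definition sep :: "('a \<Rightarrow> 'a) \<Rightarrow> 'a \<Rightarrow> 'a set" where
  "sep star x = {x, star x}"

definition seps :: "('a \<Rightarrow> 'a) \<Rightarrow> 'a set \<Rightarrow> 'a set set" where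
  "seps star A = sep star ` A"

text \<open>
  An order function \<open>ord\<close> lives on unoriented separations; \<open>oord\<close> is its extension to the
  oriented ones.
\<close>

definition oord :: "('a \<Rightarrow> 'a) \<Rightarrow> ('a set \<Rightarrow> real) \<Rightarrow> 'a \<Rightarrow> real" where
  "oord star ord x = ord (sep star x)"

definition structurally_submodular ::
  "('a::lattice \<Rightarrow> 'a) \<Rightarrow> ('a set \<Rightarrow> real) \<Rightarrow> bool" where
  "structurally_submodular star ord \<longleftrightarrow>
     (\<forall>r s. oord star ord (sup r s) \<le> oord star ord r \<or>
            oord star ord (inf r s) \<le> oord star ord s)"

definition below :: "('a \<Rightarrow> 'a) \<Rightarrow> ('a set \<Rightarrow> real) \<Rightarrow> real \<Rightarrow> 'a set" where
  "below star ord k = {x. oord star ord x < k}"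

definition degenerate :: "('a \<Rightarrow> 'a) \<Rightarrow> 'a \<Rightarrow> bool" where
  "degenerate star x \<longleftrightarrow> x = star x"

definition trivial_in :: "('a::order \<Rightarrow> 'a) \<Rightarrow> 'a set \<Rightarrow> 'a \<Rightarrow> bool" where
  "trivial_in star A x \<longleftrightarrow> x \<in> A \<and> (\<exists>t\<in>A. t < x \<and> star t < x)"

definition nested :: "'a::order set \<Rightarrow> 'a set \<Rightarrow> bool" where
  "nested s t \<longleftrightarrow> (\<exists>x\<in>s. \<exists>y\<in>t. x \<le> y \<or> y \<le> x)"

definition nested_set :: "'a::order set set \<Rightarrow> bool" where
  "nested_set N \<longleftrightarrow> (\<forall>s\<in>N. \<forall>t\<in>N. nested s t)"

definition consistent :: "('a::order \<Rightarrow> 'a) \<Rightarrow> 'a set \<Rightarrow> bool" where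
  "consistent star \<sigma> \<longleftrightarrow> \<not> (\<exists>x\<in>\<sigma>. \<exists>y\<in>\<sigma>. sep star x \<noteq> sep star y \<and> x < star y)"

definition sep_closure :: "('a::order \<Rightarrow> 'a) \<Rightarrow> 'a set \<Rightarrow> 'a set \<Rightarrow> 'a set" where
  "sep_closure star A \<sigma> = \<sigma> \<union> {y \<in> A. \<exists>x\<in>\<sigma>. sep star x \<noteq> sep star y \<and> x < y}"

definition orientation :: "('a \<Rightarrow> 'a) \<Rightarrow> 'a set \<Rightarrow> 'a set \<Rightarrow> bool" where
  "orientation star A \<tau> \<longleftrightarrow> \<tau> \<subseteq> A \<and> (\<forall>s\<in>seps star A. \<exists>!x. x \<in> s \<and> x \<in> \<tau>)"

definition has_subset_in :: "'a set \<Rightarrow> 'a set set \<Rightarrow> bool" where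
  "has_subset_in \<tau> F \<longleftrightarrow> (\<exists>\<sigma>\<subseteq>\<tau>. \<sigma> \<in> F)"


section \<open>Tangles and trees of tangles\<close>

definition tangle :: "('a::order \<Rightarrow> 'a) \<Rightarrow> 'a set \<Rightarrow> 'a set set \<Rightarrow> 'a set \<Rightarrow> bool" where
  "tangle star A F \<tau> \<longleftrightarrow>
     orientation star A \<tau> \<and> consistent star \<tau> \<and> \<not> has_subset_in \<tau> F"

definition distinguishes :: "'a set \<Rightarrow> 'a set \<Rightarrow> 'a set \<Rightarrow> bool" where
  "distinguishes s \<tau> \<tau>' \<longleftrightarrow> (\<exists>x\<in>s. \<exists>y\<in>s. x \<noteq> y \<and> x \<in> \<tau> \<and> y \<in> \<tau>')"

definition distinguishes_optimally ::
  "('a \<Rightarrow> 'a) \<Rightarrow> ('a set \<Rightarrow> real) \<Rightarrow> 'a set \<Rightarrow> 'a set \<Rightarrow> 'a set \<Rightarrow> 'a set \<Rightarrow> bool" where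
  "distinguishes_optimally star ord A s \<tau> \<tau>' \<longleftrightarrow>
     distinguishes s \<tau> \<tau>' \<and>
     \<not> (\<exists>t\<in>seps star A. ord t < ord s \<and> distinguishes t \<tau> \<tau>')"

definition tree_of_tangles ::
  "('a::order \<Rightarrow> 'a) \<Rightarrow> ('a set \<Rightarrow> real) \<Rightarrow> 'a set \<Rightarrow> 'a set set \<Rightarrow> 'a set set \<Rightarrow> bool" where
  "tree_of_tangles star ord A F N \<longleftrightarrow>
     N \<subseteq> seps star A \<and> nested_set N \<and>
     (\<forall>\<tau> \<tau>'. tangle star A F \<tau> \<and> tangle star A F \<tau>' \<and> \<tau> \<noteq> \<tau>' \<longrightarrow>
        (\<exists>s\<in>N. distinguishes_optimally star ord A s \<tau> \<tau>'))"

definition robust_sets :: "('a::lattice \<Rightarrow> 'a) \<Rightarrow> ('a set \<Rightarrow> real) \<Rightarrow> 'a set set" where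
  "robust_sets star ord =
     {{r, sup (star r) s, sup (star r) (star s)} | r s.
        oord star ord (sup (star r) s) < oord star ord r \<and>
        oord star ord (sup (star r) (star s)) < oord star ord r}"

definition standard :: "('a::order \<Rightarrow> 'a) \<Rightarrow> 'a set \<Rightarrow> 'a set set \<Rightarrow> bool" where
  "standard star A F \<longleftrightarrow> (\<forall>x. trivial_in star A x \<longrightarrow> {star x} \<in> F)"

definition weakly_eclipsed ::
  "('a::order \<Rightarrow> 'a) \<Rightarrow> ('a set \<Rightarrow> real) \<Rightarrow> 'a \<Rightarrow> 'a \<Rightarrow> bool" where
  "weakly_eclipsed star ord x y \<longleftrightarrow> y < x \<and> oord star ord y \<le> oord star ord x"

definition strongly_efficient ::
  "('a::order \<Rightarrow> 'a) \<Rightarrow> ('a set \<Rightarrow> real) \<Rightarrow> 'a set \<Rightarrow> 'a set \<Rightarrow> bool" where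
  "strongly_efficient star ord \<sigma> \<tau> \<longleftrightarrow>
     \<sigma> \<subseteq> \<tau> \<and> \<not> (\<exists>x\<in>\<sigma>. \<exists>y\<in>\<tau> - {x}. weakly_eclipsed star ord x y)"

definition rich ::
  "('a::order \<Rightarrow> 'a) \<Rightarrow> ('a set \<Rightarrow> real) \<Rightarrow> 'a set \<Rightarrow> 'a set set \<Rightarrow> bool" where
  "rich star ord A F \<longleftrightarrow>
     (\<forall>\<tau>. orientation star A \<tau> \<and> consistent star \<tau> \<and> has_subset_in \<tau> F \<longrightarrow>
        (\<exists>\<sigma>\<in>F. strongly_efficient star ord \<sigma> \<tau>))"


section \<open>Rooted trees\<close>

text \<open>A graph is given by its vertex set and its set of two-element edges.\<close>

definition simple_graph :: "'v set \<Rightarrow> 'v set set \<Rightarrow> bool" where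
  "simple_graph V E \<longleftrightarrow> (\<forall>e\<in>E. \<exists>u\<in>V. \<exists>v\<in>V. u \<noteq> v \<and> e = {u, v})"

definition graph_path :: "'v set \<Rightarrow> 'v set set \<Rightarrow> 'v list \<Rightarrow> bool" where
  "graph_path V E p \<longleftrightarrow>
     p \<noteq> [] \<and> set p \<subseteq> V \<and> distinct p \<and> successively (\<lambda>u v. {u, v} \<in> E) p"

definition graph_cycle :: "'v set \<Rightarrow> 'v set set \<Rightarrow> 'v list \<Rightarrow> bool" where
  "graph_cycle V E p \<longleftrightarrow> graph_path V E p \<and> 3 \<le> length p \<and> {last p, hd p} \<in> E"

definition path_edges :: "'v list \<Rightarrow> 'v set set" where
  "path_edges p = {{p ! i, p ! Suc i} | i. Suc i < length p}"

definition rooted_tree :: "'v set \<Rightarrow> 'v set set \<Rightarrow> 'v \<Rightarrow> bool" where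
  "rooted_tree V E r \<longleftrightarrow>
     simple_graph V E \<and> r \<in> V \<and>
     (\<forall>u\<in>V. \<forall>v\<in>V. \<exists>p. graph_path V E p \<and> hd p = u \<and> last p = v) \<and>
     \<not> (\<exists>p. graph_cycle V E p)"

definition tree_path :: "'v set \<Rightarrow> 'v set set \<Rightarrow> 'v \<Rightarrow> 'v \<Rightarrow> 'v list" where
  "tree_path V E u v = (THE p. graph_path V E p \<and> hd p = u \<and> last p = v)"

definition tree_le :: "'v set \<Rightarrow> 'v set set \<Rightarrow> 'v \<Rightarrow> 'v \<Rightarrow> 'v \<Rightarrow> bool" where
  "tree_le V E r u v \<longleftrightarrow> u \<in> V \<and> v \<in> V \<and> u \<in> set (tree_path V E r v)"

definition tree_less :: "'v set \<Rightarrow> 'v set set \<Rightarrow> 'v \<Rightarrow> 'v \<Rightarrow> 'v \<Rightarrow> bool" where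
  "tree_less V E r u v \<longleftrightarrow> tree_le V E r u v \<and> u \<noteq> v"

definition leaf :: "'v set \<Rightarrow> 'v set set \<Rightarrow> 'v \<Rightarrow> 'v \<Rightarrow> bool" where
  "leaf V E r v \<longleftrightarrow> v \<in> V \<and> \<not> (\<exists>w. tree_less V E r v w)"

definition nonleaf :: "'v set \<Rightarrow> 'v set set \<Rightarrow> 'v \<Rightarrow> 'v \<Rightarrow> bool" where
  "nonleaf V E r v \<longleftrightarrow> v \<in> V \<and> \<not> leaf V E r v"

definition child :: "'v set \<Rightarrow> 'v set set \<Rightarrow> 'v \<Rightarrow> 'v \<Rightarrow> 'v \<Rightarrow> bool" where
  "child V E r v w \<longleftrightarrow> {v, w} \<in> E \<and> tree_less V E r v w"

definition child_edges :: "'v set \<Rightarrow> 'v set set \<Rightarrow> 'v \<Rightarrow> 'v \<Rightarrow> 'v set set" where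
  "child_edges V E r v = {{v, w} | w. child V E r v w}"


section \<open>Tangle structure trees\<close>

text \<open>
  As \<open>\<beta>\<close> maps \<open>E\<^sub>v\<close> onto the two-element set of orientations of \<open>s\<^sub>v\<close> (one-element, if \<open>s\<^sub>v\<close> is
  degenerate), the unoriented separation \<open>s\<^sub>v\<close> is the image of \<open>E\<^sub>v\<close> under \<open>\<beta>\<close>.
\<close>

definition node_sep ::
  "'v set \<Rightarrow> 'v set set \<Rightarrow> 'v \<Rightarrow> ('v set \<Rightarrow> 'a) \<Rightarrow> 'v \<Rightarrow> 'a set" where
  "node_sep V E r \<beta> v = \<beta> ` child_edges V E r v"

definition path_labels ::
  "'v set \<Rightarrow> 'v set set \<Rightarrow> 'v \<Rightarrow> ('v set \<Rightarrow> 'a) \<Rightarrow> 'v \<Rightarrow> 'a set" where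
  "path_labels V E r \<beta> v = \<beta> ` path_edges (tree_path V E r v)"

definition separation_tree ::
  "('a \<Rightarrow> 'a) \<Rightarrow> 'a set \<Rightarrow> 'v set \<Rightarrow> 'v set set \<Rightarrow> 'v \<Rightarrow> ('v set \<Rightarrow> 'a) \<Rightarrow> bool" where
  "separation_tree star A V E r \<beta> \<longleftrightarrow>
     rooted_tree V E r \<and> \<beta> ` E \<subseteq> A \<and>
     (\<forall>v. nonleaf V E r v \<longrightarrow>
        (\<exists>s\<in>seps star A. bij_betw \<beta> (child_edges V E r v) s)) \<and>
     (\<forall>u v. nonleaf V E r u \<and> nonleaf V E r v \<and> tree_less V E r u v \<longrightarrow>
        node_sep V E r \<beta> u \<noteq> node_sep V E r \<beta> v)"

definition tangle_leaf ::
  "('a::order \<Rightarrow> 'a) \<Rightarrow> 'a set \<Rightarrow> 'a set set \<Rightarrow>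
   'v set \<Rightarrow> 'v set set \<Rightarrow> 'v \<Rightarrow> ('v set \<Rightarrow> 'a) \<Rightarrow> 'v \<Rightarrow> bool" where
  "tangle_leaf star A F V E r \<beta> l \<longleftrightarrow>
     leaf V E r l \<and> tangle star A F (sep_closure star A (path_labels V E r \<beta> l))"

definition forbidden_leaf ::
  "'a set set \<Rightarrow> 'v set \<Rightarrow> 'v set set \<Rightarrow> 'v \<Rightarrow> ('v set \<Rightarrow> 'a) \<Rightarrow> 'v \<Rightarrow> bool" where
  "forbidden_leaf F V E r \<beta> l \<longleftrightarrow>
     leaf V E r l \<and> has_subset_in (path_labels V E r \<beta> l) F"

definition tangle_structure_tree ::
  "('a::order \<Rightarrow> 'a) \<Rightarrow> 'a set \<Rightarrow> 'a set set \<Rightarrow>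
   'v set \<Rightarrow> 'v set set \<Rightarrow> 'v \<Rightarrow> ('v set \<Rightarrow> 'a) \<Rightarrow> bool" where
  "tangle_structure_tree star A F V E r \<beta> \<longleftrightarrow>
     separation_tree star A V E r \<beta> \<and>
     (\<forall>v\<in>V. consistent star (path_labels V E r \<beta> v)) \<and>
     (\<forall>l. leaf V E r l \<longrightarrow>
        tangle_leaf star A F V E r \<beta> l \<or> forbidden_leaf F V E r \<beta> l) \<and>
     (\<forall>v. nonleaf V E r v \<longrightarrow> \<not> has_subset_in (path_labels V E r \<beta> v) F)"

definition unoriented_by ::
  "('a::order \<Rightarrow> 'a) \<Rightarrow> 'a set \<Rightarrow> 'a set \<Rightarrow> 'a set set" where
  "unoriented_by star A \<sigma> = {s \<in> seps star A. s \<inter> sep_closure star A \<sigma> = {}}"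

definition thoroughly_ordered ::
  "('a::order \<Rightarrow> 'a) \<Rightarrow> ('a set \<Rightarrow> real) \<Rightarrow> 'a set \<Rightarrow>
   'v set \<Rightarrow> 'v set set \<Rightarrow> 'v \<Rightarrow> ('v set \<Rightarrow> 'a) \<Rightarrow> bool" where
  "thoroughly_ordered star ord A V E r \<beta> \<longleftrightarrow>
     (\<forall>v. nonleaf V E r v \<longrightarrow>
        node_sep V E r \<beta> v \<in> unoriented_by star A (path_labels V E r \<beta> v) \<and>
        (\<forall>s\<in>unoriented_by star A (path_labels V E r \<beta> v).
           ord (node_sep V E r \<beta> v) \<le> ord s))"

definition tangle_node ::
  "('a::order \<Rightarrow> 'a) \<Rightarrow> 'a set \<Rightarrow> 'a set set \<Rightarrow>
   'v set \<Rightarrow> 'v set set \<Rightarrow> 'v \<Rightarrow> ('v set \<Rightarrow> 'a) \<Rightarrow> 'v \<Rightarrow> bool" where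
  "tangle_node star A F V E r \<beta> v \<longleftrightarrow>
     nonleaf V E r v \<and>
     (\<forall>w. child V E r v w \<longrightarrow>
        (\<exists>l. tangle_leaf star A F V E r \<beta> l \<and> tree_le V E r w l))"

definition tangle_node_seps ::
  "('a::order \<Rightarrow> 'a) \<Rightarrow> 'a set \<Rightarrow> 'a set set \<Rightarrow>
   'v set \<Rightarrow> 'v set set \<Rightarrow> 'v \<Rightarrow> ('v set \<Rightarrow> 'a) \<Rightarrow> 'a set set" where
  "tangle_node_seps star A F V E r \<beta> =
     {node_sep V E r \<beta> v | v. tangle_node star A F V E r \<beta> v}"

end

theory Submission
  imports Defs
begin

text \<open>
  Given a set of labels contained in a tangle, its closure lies in that tangle too; hence following a
  tangle upwards from the root ends in a leaf whose closure is that tangle. Where two tangles part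
  ways, at a node \<open>v\<close>, every separation of order below \<open>|s\<^sub>v|\<close> is oriented by the closure of
  \<open>\<beta>\<^sub>v\<close>, so both tangles agree on it and \<open>s\<^sub>v\<close> distinguishes them optimally; as orders are
  injective, no other separation does.

  For nestedness, let \<open>r\<close> and \<open>s\<close> cross, with \<open>|r| < |s|\<close>, where \<open>s\<close> distinguishes \<open>\<tau>\<close> and
  \<open>\<tau>'\<close> optimally and \<open>r\<close> is oriented in the same way by both. Structural submodularity and the
  robust triples with first element an orientation of \<open>s\<close> leave only two cases: the two corners
  on one side of \<open>r\<close> both have order below \<open>|r|\<close>. Depending on the side, a robust triple
  with first element an orientation of \<open>r\<close> then lies in \<open>\<tau>\<close>, or in one of the tangles that
  \<open>r\<close> distinguishes optimally. A degenerate \<open>s\<^sub>v\<close> lies in every tangle, so submodularity and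
  robust triples exclude that it crosses a separation both of whose orientations occur in tangles.
\<close>

section \<open>Paths in rooted trees\<close>

lemma graph_path_Cons_Cons:
  "graph_path V E (u # v # p) \<longleftrightarrow>
     u \<in> V \<and> u \<notin> set (v # p) \<and> {u, v} \<in> E \<and> graph_path V E (v # p)"
  by (auto simp: graph_path_def)

lemma graph_path_append_left:
  assumes "graph_path V E (p @ q)" "p \<noteq> []"
  shows "graph_path V E p"
  using assms by (auto simp: graph_path_def successively_append_iff)

text \<open>Follow \<open>p\<close> up to its first vertex \<open>x\<close> on \<open>q\<close>,
  then return to \<open>u\<close> along \<open>q\<close> backwards. Taking the first such vertex
  keeps the two pieces disjoint.\<close>

lemma graph_cycle_of_diverging_paths:
  assumes p: "graph_path V E (u # p)" "p \<noteq> []" and q: "graph_path V E (u # q)" "q \<noteq> []"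
    and last: "last p = last q" and hd: "hd p \<noteq> hd q"
  shows "\<exists>c. graph_cycle V E c"
proof -
  have "\<exists>x\<in>set p. x \<in> set q" using last p(2) q(2) by (metis last_in_set)
  from split_list_first_prop[OF this]
  obtain p1 x p2 where p1: "p = p1 @ x # p2" "x \<in> set q" "\<forall>y\<in>set p1. y \<notin> set q" by blast
  obtain q1 q2 where q1: "q = q1 @ x # q2" using p1(2) by (meson split_list)
  let ?c = "u # p1 @ x # rev q1"
  have succ_rev: "successively (\<lambda>u v. {u, v} \<in> E) (x # rev q1)"
  proof -
    have "successively (\<lambda>u v. {u, v} \<in> E) (q1 @ [x])"
      using q(1) unfolding q1 graph_path_def
      by (auto simp: successively_append_iff successively_Cons)
    then have "successively (\<lambda>u v. {u, v} \<in> E) (rev (q1 @ [x]))"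
      unfolding successively_rev by (simp add: insert_commute)
    then show ?thesis by simp
  qed
  have "successively (\<lambda>u v. {u, v} \<in> E) (u # p1 @ [x])"
    using p(1) successively_append_iff[of _ "u # p1 @ [x]" p2] unfolding p1(1) graph_path_def by simp
  then have "successively (\<lambda>u v. {u, v} \<in> E) ?c"
    using succ_rev successively_append_iff[of _ "u # p1" "x # rev q1"]
      successively_append_iff[of _ "u # p1" "[x]"] by simp
  moreover have "set ?c \<subseteq> V" "distinct ?c"
    using p(1) q(1) p1(3) unfolding p1(1) q1 graph_path_def by auto
  ultimately have "graph_path V E ?c" unfolding graph_path_def by blast
  \<comment> \<open>If both were empty, \<open>p\<close> and \<open>q\<close> would both start with
    \<open>x\<close>; so the closed walk has at least three vertices.\<close>
  moreover have "p1 \<noteq> [] \<or> q1 \<noteq> []" using hd p1(1) q1 by auto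
  then have "3 \<le> length ?c" by (cases p1; cases q1) auto
  moreover have "{last ?c, hd ?c} \<in> E"
    using q(1) unfolding q1 graph_path_def
    by (cases q1) (auto simp: successively_Cons insert_commute)
  ultimately show ?thesis unfolding graph_cycle_def by blast
qed

text \<open>Induction strips the common first vertex; if the next vertices differed, the diverging
  paths would close up to a cycle.\<close>

lemma graph_path_unique:
  assumes acyclic: "\<nexists>c. graph_cycle V E c"
    and "graph_path V E p" "graph_path V E q" "hd p = hd q" "last p = last q"
  shows "p = q"
  using assms(2-)
proof (induction p arbitrary: q)
  case Nil
  then show ?case by (simp add: graph_path_def)
next
  case (Cons u p)
  obtain q' where q: "q = u # q'"
    using Cons.prems by (cases q) (auto simp: graph_path_def)
  show ?case
  proof (cases "p = [] \<or> q' = []")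
    case True
    then show ?thesis using Cons.prems unfolding q graph_path_def
      by (metis distinct.simps(2) last_ConsL last_ConsR last_in_set list.sel(1))
  next
    case False
    then have "last p = last q'" using Cons.prems(4) q by simp
    then have "hd p = hd q'"
      using graph_cycle_of_diverging_paths[of V E u p q'] Cons.prems False acyclic unfolding q
      by blast
    moreover have "graph_path V E p" "graph_path V E q'"
      using False Cons.prems(1,2) graph_path_Cons_Cons unfolding q
      by (metis list.exhaust)+
    ultimately show ?thesis using Cons.IH \<open>last p = last q'\<close> q by blast
  qed
qed

lemma path_edges_snoc:
  assumes "p \<noteq> []"
  shows "path_edges (p @ [w]) = insert {last p, w} (path_edges p)"
proof -
  \<comment> \<open>The one new index \<open>length p - 1\<close> belongs to the edge from
    \<open>last p\<close> to \<open>w\<close>; it is a genuine position because \<open>p\<close> is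
    nonempty.\<close>
  have "{i. Suc i < length (p @ [w])} = insert (length p - 1) {i. Suc i < length p}"
    using assms by (cases p) auto
  then have "path_edges (p @ [w]) =
      (\<lambda>i. {(p @ [w]) ! i, (p @ [w]) ! Suc i}) ` insert (length p - 1) {i. Suc i < length p}"
    unfolding path_edges_def by blast
  also have "\<dots> = insert {last p, w} (path_edges p)"
    using assms unfolding path_edges_def
    by (auto simp: nth_append last_conv_nth image_def)
  finally show ?thesis .
qed

lemma path_edges_append_mono: "path_edges p \<subseteq> path_edges (p @ q)"
  unfolding path_edges_def by (force simp: nth_append)

section \<open>Root paths and the tree order\<close>

locale rooted =
  fixes V :: "'v set" and E :: "'v set set" and r :: 'v
  assumes rooted_tree: "rooted_tree V E r"
begin

lemma tree_path_eqI:
  assumes "graph_path V E p" "hd p = r" "last p = v"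
  shows "tree_path V E r v = p"
  unfolding tree_path_def
proof (rule the_equality)
  fix q assume "graph_path V E q \<and> hd q = r \<and> last q = v"
  then show "q = p"
    using graph_path_unique[of V E q p] rooted_tree assms unfolding rooted_tree_def by auto
qed (use assms in simp)

lemma tree_path:
  assumes "v \<in> V"
  shows "graph_path V E (tree_path V E r v)" "hd (tree_path V E r v) = r"
    "last (tree_path V E r v) = v" "tree_path V E r v \<noteq> []"
proof -
  obtain p where "graph_path V E p" "hd p = r" "last p = v"
    using rooted_tree assms unfolding rooted_tree_def by meson
  with tree_path_eqI show "graph_path V E (tree_path V E r v)" "hd (tree_path V E r v) = r"
    "last (tree_path V E r v) = v" "tree_path V E r v \<noteq> []"
    by (auto simp: graph_path_def)
qed

lemma tree_path_root: "tree_path V E r r = [r]"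
  using rooted_tree by (intro tree_path_eqI) (auto simp: graph_path_def rooted_tree_def)

lemma tree_path_prefix:
  assumes "v \<in> V" "tree_path V E r v = p @ q" "p \<noteq> []"
  shows "tree_path V E r (last p) = p"
  using tree_path[OF assms(1)] assms(2,3)
  by (intro tree_path_eqI) (auto intro: graph_path_append_left)

text \<open>Initial segments of root paths are root paths, so the tree order is the prefix order on
  them; transitivity and monotonicity of labels follow at once.\<close>

lemma tree_le_iff:
  "tree_le V E r u v \<longleftrightarrow> u \<in> V \<and> v \<in> V \<and> (\<exists>q. tree_path V E r v = tree_path V E r u @ q)"
proof -
  have "u \<in> set (tree_path V E r v) \<longleftrightarrow> (\<exists>q. tree_path V E r v = tree_path V E r u @ q)"
    if "u \<in> V" "v \<in> V"
  proof
    assume "u \<in> set (tree_path V E r v)"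
    then obtain p q where "tree_path V E r v = (p @ [u]) @ q"
      by (metis append.assoc append_Cons append_Nil split_list)
    with tree_path_prefix[OF that(2) this] show "\<exists>q. tree_path V E r v = tree_path V E r u @ q"
      by auto
  next
    assume "\<exists>q. tree_path V E r v = tree_path V E r u @ q"
    then show "u \<in> set (tree_path V E r v)"
      using tree_path(3,4)[OF that(1)] by (metis UnI1 last_in_set set_append)
  qed
  then show ?thesis unfolding tree_le_def by blast
qed

lemma tree_le_refl: "v \<in> V \<Longrightarrow> tree_le V E r v v"
  by (simp add: tree_le_iff)

lemma tree_le_trans: "tree_le V E r u v \<Longrightarrow> tree_le V E r v w \<Longrightarrow> tree_le V E r u w"
  by (auto simp: tree_le_iff)

lemma childD:
  assumes "child V E r v w"
  shows "v \<in> V" "w \<in> V" "tree_path V E r w = tree_path V E r v @ [w]" "tree_le V E r v w"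
proof -
  show le: "tree_le V E r v w" and vV: "v \<in> V" and wV: "w \<in> V"
    using assms by (auto simp: child_def tree_less_def tree_le_iff)
  obtain q where q: "tree_path V E r w = tree_path V E r v @ q" using le tree_le_iff by blast
  \<comment> \<open>As \<open>q\<close> is nonempty, \<open>w\<close> lies beyond the path to
    \<open>v\<close>. Appending the edge to \<open>w\<close> therefore gives a path, which must be
    the root path of \<open>w\<close> by uniqueness.\<close>
  have "q \<noteq> []"
    using q tree_path(3)[OF vV] tree_path(3)[OF wV] assms by (auto simp: child_def tree_less_def)
  then have "w \<in> set q" using q tree_path(3)[OF wV] by (metis last_appendR last_in_set)
  then have "w \<notin> set (tree_path V E r v)"
    using tree_path(1)[OF wV] q by (auto simp: graph_path_def)
  then have "graph_path V E (tree_path V E r v @ [w])"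
    using tree_path[OF vV] wV assms
    by (auto simp: graph_path_def successively_append_iff child_def)
  then show "tree_path V E r w = tree_path V E r v @ [w]"
    using tree_path[OF vV] by (intro tree_path_eqI) auto
qed

lemma path_labels_child:
  assumes "child V E r v w"
  shows "path_labels V E r \<beta> w = insert (\<beta> {v, w}) (path_labels V E r \<beta> v)"
  unfolding path_labels_def
  using childD[OF assms] tree_path[OF childD(1)[OF assms]] by (simp add: path_edges_snoc)

lemma path_labels_mono:
  assumes "tree_le V E r u v"
  shows "path_labels V E r \<beta> u \<subseteq> path_labels V E r \<beta> v"
  using assms path_edges_append_mono unfolding path_labels_def tree_le_iff
  by (metis image_mono)

lemma path_labels_root: "path_labels V E r \<beta> r = {}"
  by (simp add: path_labels_def tree_path_root path_edges_def)

end

section \<open>Tangles in universes with a submodular order function\<close>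

locale submodular_universe =
  fixes star :: "'a::lattice \<Rightarrow> 'a" and ord :: "'a set \<Rightarrow> real" and k :: real and F :: "'a set set"
  assumes universe: "universe star"
    and ord_inj: "inj_on ord (seps star UNIV)"
    and submodular: "structurally_submodular star ord"
    and robust: "robust_sets star ord \<subseteq> F"
begin

abbreviation A :: "'a set" where "A \<equiv> below star ord k"
abbreviation osize :: "'a \<Rightarrow> real" where "osize x \<equiv> oord star ord x"

lemma star_star [simp]: "star (star x) = x"
  using universe by (simp add: universe_def)

lemma star_antimono: "x \<le> y \<Longrightarrow> star y \<le> star x"
  using universe by (simp add: universe_def antimonoD)

lemma star_sup: "star (sup x y) = inf (star x) (star y)"
proof (rule order.antisym)
  show "star (sup x y) \<le> inf (star x) (star y)"
    by (simp add: star_antimono)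
  have "x \<le> star (inf (star x) (star y))" "y \<le> star (inf (star x) (star y))"
    using star_antimono[OF inf_le1[of "star x" "star y"]]
      star_antimono[OF inf_le2[of "star x" "star y"]] by simp_all
  then show "inf (star x) (star y) \<le> star (sup x y)"
    using star_antimono[OF sup_least] by fastforce
qed

lemma sep_eq_iff: "sep star x = sep star y \<longleftrightarrow> x = y \<or> x = star y"
  by (auto simp: sep_def doubleton_eq_iff)

lemma osize_star [simp]: "osize (star x) = osize x"
  by (simp add: oord_def sep_def insert_commute)

lemma osize_eqD: "osize x = osize y \<Longrightarrow> x = y \<or> x = star y"
  using inj_onD[OF ord_inj, of "sep star x" "sep star y"]
  by (auto simp: oord_def seps_def sep_eq_iff)

lemma ord_sep: "ord (sep star x) = osize x"
  by (simp add: oord_def)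

lemma in_seps_iff: "s \<in> seps star A \<longleftrightarrow> (\<exists>x\<in>A. s = sep star x)"
  by (auto simp: seps_def)

lemma star_in_A [simp]: "star x \<in> A \<longleftrightarrow> x \<in> A"
  by (simp add: below_def)

lemma in_A_mono: "x \<in> A \<Longrightarrow> osize y \<le> osize x \<Longrightarrow> y \<in> A"
  by (simp add: below_def)

lemma osize_inf_star: "osize (sup (star x) (star y)) = osize (inf x y)"
  using osize_star[of "sup (star x) (star y)"] by (simp add: star_sup)

text \<open>The infimum is replaced by the inverse corner, of equal order, because robust triples
  are written with suprema only.\<close>

lemma submodularD: "osize (sup x y) \<le> osize x \<or> osize (sup (star x) (star y)) \<le> osize y"
  using submodular unfolding structurally_submodular_def osize_inf_star by simp

section \<open>How tangles orient separations\<close>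

lemma tangle_subset: "tangle star A F \<tau> \<Longrightarrow> \<tau> \<subseteq> A"
  by (simp add: tangle_def orientation_def)

lemma tangle_total:
  assumes "tangle star A F \<tau>" "x \<in> A"
  shows "x \<in> \<tau> \<or> star x \<in> \<tau>"
proof -
  have "sep star x \<in> seps star A" using assms(2) by (simp add: seps_def)
  then have "\<exists>!y. y \<in> sep star x \<and> y \<in> \<tau>" using assms(1) by (simp add: tangle_def orientation_def)
  then show ?thesis by (auto simp: sep_def)
qed

lemma tangle_unique:
  assumes "tangle star A F \<tau>" "s \<in> seps star A" "x \<in> s" "y \<in> s" "x \<in> \<tau>" "y \<in> \<tau>"
  shows "x = y"
  using assms unfolding tangle_def orientation_def by blast

lemma tangle_star:
  assumes "tangle star A F \<tau>" "x \<in> \<tau>" "star x \<in> \<tau>"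
  shows "star x = x"
  using tangle_unique[OF assms(1), of "sep star x" "star x" x] assms tangle_subset[OF assms(1)]
  by (auto simp: seps_def sep_def)

lemma tangle_up:
  assumes "tangle star A F \<tau>" "x \<in> \<tau>" "x < y" "y \<in> A" "sep star x \<noteq> sep star y"
  shows "y \<in> \<tau>"
proof (rule ccontr)
  assume "y \<notin> \<tau>"
  then have "star y \<in> \<tau>" using tangle_total assms by blast
  moreover have "sep star x \<noteq> sep star (star y)" using assms(5) sep_eq_iff by auto
  moreover have "x < star (star y)" using assms(3) by simp
  ultimately show False using assms(1,2) unfolding tangle_def consistent_def by blast
qed

text \<open>Different orders force different underlying separations, hence also a strict inequality;
  this suits corners, which are compared by order.\<close>

lemma tangle_up_osize:
  assumes "tangle star A F \<tau>" "x \<in> \<tau>" "x \<le> y" "y \<in> A" "osize x \<noteq> osize y"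
  shows "y \<in> \<tau>"
proof -
  have "sep star x \<noteq> sep star y" using assms(5) by (auto simp: oord_def)
  moreover then have "x < y" using assms(3) by (auto simp: less_le)
  ultimately show ?thesis using tangle_up assms by blast
qed

lemma tangle_closure:
  assumes "tangle star A F \<tau>" "\<sigma> \<subseteq> \<tau>"
  shows "sep_closure star A \<sigma> \<subseteq> \<tau>"
  using assms tangle_up[OF assms(1)] unfolding sep_closure_def by blast

text \<open>Both orient the same separations: if \<open>\<tau>\<close> contained the inverse of some
  \<open>x\<close> in \<open>\<tau>'\<close>, then so would \<open>\<tau>'\<close>, making
  \<open>x\<close> degenerate.\<close>

lemma tangle_subset_eq:
  assumes "tangle star A F \<tau>" "tangle star A F \<tau>'" "\<tau> \<subseteq> \<tau>'"
  shows "\<tau> = \<tau>'"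
proof
  show "\<tau>' \<subseteq> \<tau>"
  proof
    fix x assume "x \<in> \<tau>'"
    then have "x \<in> A" using assms tangle_subset by blast
    then show "x \<in> \<tau>" using tangle_total[OF assms(1)] tangle_star[OF assms(2)] \<open>x \<in> \<tau>'\<close> assms(3)
      by force
  qed
qed fact

lemma tangle_robust:
  assumes "tangle star A F \<tau>" "x \<in> \<tau>" "sup (star x) y \<in> \<tau>" "sup (star x) (star y) \<in> \<tau>"
    and "osize (sup (star x) y) < osize x" "osize (sup (star x) (star y)) < osize x"
  shows False
proof -
  have "{x, sup (star x) y, sup (star x) (star y)} \<in> F"
    using robust assms(5,6) unfolding robust_sets_def by blast
  moreover have "{x, sup (star x) y, sup (star x) (star y)} \<subseteq> \<tau>" using assms(2-4) by simp
  ultimately show False using assms(1) unfolding tangle_def has_subset_in_def by metis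
qed

section \<open>Crossing separations and their corners\<close>

lemma nested_sepI:
  assumes "x \<le> y \<or> x \<le> star y \<or> star x \<le> y \<or> star x \<le> star y"
  shows "nested (sep star x) (sep star y)"
  using assms by (auto simp: nested_def sep_def)

lemma nested_commute: "nested s t \<longleftrightarrow> nested t s"
  by (auto simp: nested_def)

text \<open>By injectivity, a corner with the order of \<open>x\<close> or \<open>y\<close> would be
  an orientation of it and so witness nestedness. For crossing separations the submodular
  inequalities are therefore strict.\<close>

lemma osize_sup_neq:
  assumes "\<not> nested (sep star x) (sep star y)" "w \<in> {x, star x}" "z \<in> {y, star y}"
  shows "osize (sup w z) \<noteq> osize x" "osize (sup w z) \<noteq> osize y"
proof -
  have "w \<le> sup w z" "z \<le> sup w z" by simp_all
  moreover have "\<not> w \<le> y" "\<not> w \<le> star y" "\<not> z \<le> x" "\<not> z \<le> star x"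
    using assms by (auto simp: nested_def sep_def)
  ultimately show "osize (sup w z) \<noteq> osize x" "osize (sup w z) \<noteq> osize y"
    using osize_eqD by metis+
qed

text \<open>Since \<open>x\<close> lies in every tangle, so does each corner \<open>sup x z\<close>
  of small order. As \<open>star x = x\<close>, the two corners on one side of \<open>y\<close>
  coincide, so robust triples starting with \<open>y\<close> or \<open>star y\<close> forbid a
  corner of order below \<open>osize y\<close>. Submodularity then makes both corners smaller than
  \<open>x\<close>, and the triple starting with \<open>x\<close> is left.\<close>

lemma nested_degenerate:
  assumes x: "star x = x" "x \<in> A" and y: "y \<in> A"
    and \<tau>: "tangle star A F \<tau>" "y \<in> \<tau>" and \<tau>': "tangle star A F \<tau>'" "star y \<in> \<tau>'"
  shows "nested (sep star x) (sep star y)"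
proof (rule ccontr)
  assume cross: "\<not> ?thesis"
  have up: "sup x z \<in> \<rho>" if "z \<in> {y, star y}" "osize (sup x z) < osize w" "w \<in> A"
    "tangle star A F \<rho>" for z w \<rho>
  proof -
    have "x \<in> \<rho>" using tangle_total[OF that(4) x(2)] unfolding x(1) by blast
    moreover have "sup x z \<in> A" using in_A_mono[OF that(3) less_imp_le[OF that(2)]] .
    moreover have "osize x \<noteq> osize (sup x z)"
      using osize_sup_neq(1)[OF cross _ that(1), of x] by simp
    ultimately show ?thesis using tangle_up_osize[OF that(4) _ sup_ge1] by blast
  qed
  have 1: "\<not> osize (sup x (star y)) < osize y"
    using tangle_robust[OF \<tau>, of x] up[OF _ _ y \<tau>(1), of "star y"]
    by (auto simp: x(1) sup_commute[of _ x])
  have 2: "\<not> osize (sup x y) < osize y"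
    using tangle_robust[OF \<tau>', of x] up[OF _ _ y \<tau>'(1), of y]
    by (auto simp: x(1) sup_commute[of _ x])
  have "osize (sup x y) < osize x"
    using submodularD[of x y] 1 osize_sup_neq[OF cross, of x y]
      osize_sup_neq[OF cross, of x "star y"] by (simp add: x(1))
  moreover have "osize (sup x (star y)) < osize x"
    using submodularD[of x "star y"] 2 osize_sup_neq[OF cross, of x y]
      osize_sup_neq[OF cross, of x "star y"] by (simp add: x(1))
  moreover have "x \<in> \<tau>" using tangle_total[OF \<tau>(1) x(2)] x(1) by simp
  ultimately show False
    using tangle_robust[OF \<tau>(1), of x y] up[OF _ _ x(2) \<tau>(1), of y]
      up[OF _ _ x(2) \<tau>(1), of "star y"] by (auto simp: x(1))
qed

lemma distinguishes_optimally_sepD: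
  assumes "tangle star A F \<tau>" "tangle star A F \<tau>'"
    and "distinguishes_optimally star ord A (sep star x) \<tau> \<tau>'"
    and "y \<in> A" "osize y < osize x" "y \<in> \<tau>"
  shows "y \<in> \<tau>'"
proof (rule ccontr)
  assume "y \<notin> \<tau>'"
  then have "star y \<in> \<tau>'" using tangle_total assms by blast
  then have "distinguishes (sep star y) \<tau> \<tau>'"
    using \<open>y \<notin> \<tau>'\<close> \<open>y \<in> \<tau>\<close> by (auto simp: distinguishes_def sep_def)
  moreover have "sep star y \<in> seps star A" using assms(4) in_seps_iff by blast
  ultimately show False
    using assms(3,5) unfolding distinguishes_optimally_def ord_sep[symmetric] by blast
qed

lemma distinguishes_optimally_sym:
  "distinguishes_optimally star ord A s \<tau> \<tau>' \<Longrightarrow> distinguishes_optimally star ord A s \<tau>' \<tau>"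
proof -
  have "distinguishes t \<tau> \<tau>' \<longleftrightarrow> distinguishes t \<tau>' \<tau>" for t :: "'a set"
    unfolding distinguishes_def by metis
  then show "distinguishes_optimally star ord A s \<tau> \<tau>' \<Longrightarrow>
      distinguishes_optimally star ord A s \<tau>' \<tau>"
    unfolding distinguishes_optimally_def by simp
qed

text \<open>Corners of order below \<open>osize y\<close> can be moved between \<open>\<tau>\<close>
  and \<open>\<tau>'\<close>, and those below \<open>osize x\<close> between \<open>\<rho>\<close>
  and \<open>\<rho>'\<close>. This places whole robust triples inside one tangle.\<close>

lemma nested_optimal_less:
  assumes \<tau>: "tangle star A F \<tau>" "tangle star A F \<tau>'" "y \<in> \<tau>" "star y \<in> \<tau>'"
    and opt_y: "distinguishes_optimally star ord A (sep star y) \<tau> \<tau>'"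
    and \<rho>: "tangle star A F \<rho>" "tangle star A F \<rho>'" "x \<in> \<rho>" "star x \<in> \<rho>'"
    and opt_x: "distinguishes_optimally star ord A (sep star x) \<rho> \<rho>'"
    and less: "osize x < osize y" and x_in: "x \<in> \<tau>"
  shows "nested (sep star x) (sep star y)"
proof (rule ccontr)
  assume cross: "\<not> ?thesis"
  have A: "x \<in> A" "y \<in> A" using \<tau> x_in tangle_subset by blast+
  have x_in': "x \<in> \<tau>'" using distinguishes_optimally_sepD[OF \<tau>(1,2) opt_y] A less x_in by blast
  note neq = osize_sup_neq[OF cross]
  have up_x: "sup x z \<in> \<pi>"
    if "z \<in> {y, star y}" "osize (sup x z) < osize y" "tangle star A F \<pi>" "x \<in> \<pi>" for z \<pi>
    using tangle_up_osize[OF that(3,4), of "sup x z"] neq[of x z] that in_A_mono[OF A(2)]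
    by force
  \<comment> \<open>The corner lies above \<open>star y\<close>, so it enters \<open>\<tau>'\<close>
    first; optimality carries it over to \<open>\<tau>\<close>.\<close>
  have corner_star: "sup (star x) (star y) \<in> \<tau>" if "osize (sup (star x) (star y)) < osize y"
  proof -
    have "sup (star x) (star y) \<in> A" using in_A_mono[OF A(2)] that by simp
    moreover from this have "sup (star x) (star y) \<in> \<tau>'"
      using tangle_up_osize[OF \<tau>(2,4), of "sup (star x) (star y)"] that by simp
    ultimately show ?thesis
      using distinguishes_optimally_sepD[OF \<tau>(2,1) distinguishes_optimally_sym[OF opt_y]] that
      by blast
  qed
  have corner: "sup (star x) y \<in> \<tau>" "sup (star x) y \<in> \<tau>'" if "osize (sup (star x) y) < osize y"
  proof -
    have "sup (star x) y \<in> A" using in_A_mono[OF A(2)] that by simp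
    moreover from this show "sup (star x) y \<in> \<tau>"
      using tangle_up_osize[OF \<tau>(1,3), of "sup (star x) y"] that by simp
    ultimately show "sup (star x) y \<in> \<tau>'"
      using distinguishes_optimally_sepD[OF \<tau>(1,2) opt_y] that by blast
  qed
  \<comment> \<open>Otherwise the robust triple starting with \<open>y\<close> lies in
    \<open>\<tau>\<close>; the next fact uses \<open>star y\<close> and \<open>\<tau>'\<close>
    likewise.\<close>
  have 1: "\<not> (osize (sup x (star y)) < osize y \<and> osize (sup (star x) (star y)) < osize y)"
    using tangle_robust[OF \<tau>(1,3), of x] up_x[of "star y" \<tau>] corner_star \<tau> x_in
    by (auto simp: sup_commute)
  have 2: "\<not> (osize (sup x y) < osize y \<and> osize (sup (star x) y) < osize y)"
    using tangle_robust[OF \<tau>(2,4), of x] up_x[of y \<tau>'] corner \<tau> x_in'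
    by (auto simp: sup_commute)
  have "osize (sup x y) < osize x \<or> osize (sup (star x) (star y)) < osize y"
    "osize (sup x y) < osize y \<or> osize (sup (star x) (star y)) < osize x"
    using submodularD[of x y] submodularD[of y x] neq[of x y] neq[of "star x" "star y"]
    by (simp_all add: sup_commute less_le)
  moreover have "osize (sup x (star y)) < osize x \<or> osize (sup (star x) y) < osize y"
    "osize (sup x (star y)) < osize y \<or> osize (sup (star x) y) < osize x"
    using submodularD[of x "star y"] submodularD[of "star y" x] neq[of x "star y"] neq[of "star x" y]
    by (simp_all add: sup_commute less_le)
  \<comment> \<open>If \<open>sup x y\<close> is smaller than \<open>x\<close>, then
    \<open>2\<close> makes \<open>sup (star x) y\<close> large, and submodularity makes
    \<open>sup x (star y)\<close> smaller than \<open>x\<close>. If not,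
    \<open>sup (star x) (star y)\<close> is smaller than \<open>y\<close>, and \<open>1\<close>,
    submodularity and \<open>2\<close> in turn give the other alternative.\<close>
  ultimately have "osize (sup x y) < osize x \<and> osize (sup x (star y)) < osize x \<or>
      osize (sup (star x) y) < osize x \<and> osize (sup (star x) (star y)) < osize x"
    using 1 2 less by argo
  then show False
  proof
    assume small: "osize (sup (star x) y) < osize x \<and> osize (sup (star x) (star y)) < osize x"
    then show False
      using tangle_robust[OF \<tau>(1) x_in, of y] corner corner_star less by auto
  next
    assume small: "osize (sup x y) < osize x \<and> osize (sup x (star y)) < osize x"
    \<comment> \<open>The triple now starts with \<open>star x\<close>, which \<open>\<tau>\<close>
      need not contain. The corners lie above \<open>x\<close> in \<open>\<rho>\<close>, and
      optimality of \<open>x\<close> moves them to \<open>\<rho>'\<close>.\<close>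
    have "sup x z \<in> \<rho>'" if "z \<in> {y, star y}" for z
    proof -
      have "osize (sup x z) < osize x" using that small by auto
      moreover from this have "sup x z \<in> \<rho>" "sup x z \<in> A"
        using up_x[OF that _ \<rho>(1,3)] less in_A_mono[OF A(1)] by auto
      ultimately show ?thesis using distinguishes_optimally_sepD[OF \<rho>(1,2) opt_x] by blast
    qed
    then show False using tangle_robust[OF \<rho>(2,4), of y] small by auto
  qed
qed

section \<open>Separations distinguishing two tangles optimally\<close>

definition optimal :: "'a set \<Rightarrow> bool" where
  "optimal s \<longleftrightarrow> s \<in> seps star A \<and> (\<exists>\<tau> \<tau>'. tangle star A F \<tau> \<and> tangle star A F \<tau>' \<and>
     distinguishes_optimally star ord A s \<tau> \<tau>')"

lemma optimalE:
  assumes "optimal s"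
  obtains x \<tau> \<tau>' where "tangle star A F \<tau>" "tangle star A F \<tau>'"
    "distinguishes_optimally star ord A s \<tau> \<tau>'" "s = sep star x" "x \<in> \<tau>" "star x \<in> \<tau>'"
    "x \<in> A" "x \<noteq> star x"
proof -
  from assms have s: "s \<in> seps star A"
    unfolding optimal_def by (rule conjunct1)
  from assms have ex: "\<exists>\<tau> \<tau>'. tangle star A F \<tau> \<and>
      tangle star A F \<tau>' \<and> distinguishes_optimally star ord A s \<tau> \<tau>'"
    unfolding optimal_def by (rule conjunct2)
  obtain z where z: "s = sep star z" "z \<in> A" using s unfolding seps_def by (rule imageE)
  obtain \<tau> \<tau>' where *: "tangle star A F \<tau>" "tangle star A F \<tau>'"
    "distinguishes_optimally star ord A s \<tau> \<tau>'" using ex by metis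
  from *(3) have "distinguishes (sep star z) \<tau> \<tau>'"
    unfolding distinguishes_optimally_def z(1) by (rule conjunct1)
  then have "(z \<in> \<tau> \<and> star z \<in> \<tau>' \<or> star z \<in> \<tau> \<and> z \<in> \<tau>') \<and> z \<noteq> star z"
    unfolding distinguishes_def sep_def by auto
  moreover have "sep star (star z) = sep star z" by (simp add: sep_eq_iff)
  ultimately show thesis using that[of \<tau> \<tau>' z] that[of \<tau> \<tau>' "star z"] * z by auto
qed

lemma nested_optimal:
  assumes "optimal s" "optimal t"
  shows "nested s t"
proof -
  have *: "nested s t" if st: "optimal s" "optimal t" "ord s < ord t" for s t
  proof -
    obtain y \<tau> \<tau>' where y: "tangle star A F \<tau>" "tangle star A F \<tau>'"
      "distinguishes_optimally star ord A t \<tau> \<tau>'" "t = sep star y" "y \<in> \<tau>" "star y \<in> \<tau>'"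
      using st(2) by (rule optimalE)
    obtain x \<rho> \<rho>' where x: "tangle star A F \<rho>" "tangle star A F \<rho>'"
      "distinguishes_optimally star ord A s \<rho> \<rho>'" "s = sep star x" "x \<in> \<rho>" "star x \<in> \<rho>'" "x \<in> A"
      using st(1) by (rule optimalE)
    have s: "s = sep star (star x)" using x(4) sep_eq_iff by simp
    have less: "osize x < osize y" using st(3) x(4) y(4) by (simp add: oord_def)
    show ?thesis
    proof (cases "x \<in> \<tau>")
      case True
      then show ?thesis
        using nested_optimal_less[of \<tau> \<tau>' y \<rho> \<rho>' x] x y less by simp
    next
      case False
      \<comment> \<open>The previous case applies to \<open>star x\<close> after exchanging
        \<open>\<rho>\<close> and \<open>\<rho>'\<close>.\<close>
      then have "star x \<in> \<tau>" using tangle_total x y by blast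
      then show ?thesis
        using nested_optimal_less[of \<tau> \<tau>' y \<rho>' \<rho> "star x"] x y less s
          distinguishes_optimally_sym[OF x(3)] by simp
    qed
  qed
  consider "ord s < ord t" | "ord t < ord s" | "ord s = ord t" by linarith
  then show ?thesis
  proof cases
    \<comment> \<open>Equal orders mean the same separation, by injectivity, and a separation is
      nested with itself.\<close>
    case 3
    then obtain x y where "s = sep star x" "t = sep star y" "osize x = osize y"
      using assms unfolding optimal_def in_seps_iff by (auto simp: ord_sep)
    then show ?thesis using osize_eqD nested_sepI by blast
  qed (use * assms nested_commute in blast)+
qed

end

section \<open>Thoroughly ordered tangle structure trees\<close>

locale ordered_structure_tree =
  submodular_universe star ord k F + rooted V E r
  for star :: "'a::{finite, lattice} \<Rightarrow> 'a" and ord k F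
    and V :: "'v set" and E :: "'v set set" and r :: 'v +
  fixes \<beta> :: "'v set \<Rightarrow> 'a"
  assumes structure_tree: "tangle_structure_tree star A F V E r \<beta>"
    and ordered: "thoroughly_ordered star ord A V E r \<beta>"
begin

abbreviation labels :: "'v \<Rightarrow> 'a set" where "labels \<equiv> path_labels V E r \<beta>"
abbreviation vsep :: "'v \<Rightarrow> 'a set" where "vsep \<equiv> node_sep V E r \<beta>"

lemma nonleaf_bij:
  assumes "nonleaf V E r v"
  shows "vsep v \<in> seps star A" "bij_betw \<beta> (child_edges V E r v) (vsep v)"
proof -
  obtain s where "s \<in> seps star A" "bij_betw \<beta> (child_edges V E r v) s"
    using structure_tree assms unfolding tangle_structure_tree_def separation_tree_def by blast
  then show "vsep v \<in> seps star A" "bij_betw \<beta> (child_edges V E r v) (vsep v)"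
    by (auto simp: node_sep_def bij_betw_def)
qed

lemma vsep_child:
  assumes "x \<in> vsep v"
  obtains w where "child V E r v w" "\<beta> {v, w} = x"
  using assms unfolding node_sep_def child_edges_def by blast

lemma child_vsep: "child V E r v w \<Longrightarrow> \<beta> {v, w} \<in> vsep v"
  unfolding node_sep_def child_edges_def by blast

text \<open>The non-leaf nodes on a root path carry distinct separations, and there are only
  finitely many of these. The extra \<open>Suc\<close> counts the final vertex, which may be a
  leaf.\<close>

lemma depth_bounded:
  assumes "v \<in> V"
  shows "length (tree_path V E r v) \<le> Suc (card (UNIV :: 'a set set))"
proof -
  let ?p = "tree_path V E r v"
  have less: "tree_less V E r (?p ! i) (?p ! j)" if "i < j" "j < length ?p" for i j
  proof -
    have tp: "tree_path V E r (?p ! l) = take (Suc l) ?p" if "l < length ?p" for l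
      using tree_path_prefix[OF assms append_take_drop_id[symmetric], of "Suc l"] that
      by (simp add: take_Suc_conv_app_nth)
    have "take (Suc j) ?p = take (Suc i) ?p @ drop (Suc i) (take (Suc j) ?p)"
      using that by (metis append_take_drop_id min.absorb1 Suc_le_mono less_imp_le_nat take_take)
    moreover have "set ?p \<subseteq> V" "distinct ?p" using tree_path[OF assms] by (auto simp: graph_path_def)
    ultimately show ?thesis
      using that tp[of i] tp[of j] unfolding tree_less_def tree_le_iff
      by (auto simp: nth_eq_iff_index_eq)
  qed
  let ?n = "length ?p - 1"
  have nonleaf: "nonleaf V E r (?p ! i)" if "i < ?n" for i
  proof -
    have "tree_less V E r (?p ! i) (?p ! Suc i)" using less[of i "Suc i"] that by simp
    then show ?thesis unfolding nonleaf_def leaf_def by (auto simp: tree_less_def tree_le_def)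
  qed
  have "vsep (?p ! i) \<noteq> vsep (?p ! j)" if "i < j" "j < ?n" for i j
    using structure_tree nonleaf[of i] nonleaf[of j] less[of i j] that
    unfolding tangle_structure_tree_def separation_tree_def by simp
  then have "inj_on (\<lambda>i. vsep (?p ! i)) {..<?n}"
    by (intro linorder_inj_onI) auto
  then have "card {..<?n} \<le> card (UNIV :: 'a set set)"
    by (rule card_inj_on_le) auto
  then show ?thesis by simp
qed

text \<open>Bounded depth allows a node of greatest depth to be chosen; this replaces a recursive
  descent into the tree.\<close>

lemma deepest:
  assumes "v \<in> V" "P v"
  obtains w where "w \<in> V" "P w" "\<And>u. child V E r w u \<Longrightarrow> \<not> P u"
proof -
  let ?d = "\<lambda>w. length (tree_path V E r w)"
  have "\<forall>u. u \<in> V \<and> P u \<longrightarrow> ?d u < Suc (Suc (card (UNIV :: 'a set set)))"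
    using depth_bounded by (simp add: less_Suc_eq_le)
  with ex_has_greatest_nat[of "\<lambda>w. w \<in> V \<and> P w" v ?d] assms
  obtain w where w: "w \<in> V \<and> P w" "\<forall>u. u \<in> V \<and> P u \<longrightarrow> ?d u \<le> ?d w"
    by meson
  have "\<not> P u" if "child V E r w u" for u
    using w(2)[rule_format, of u] childD[OF that] by auto
  then show thesis using that w(1) by blast
qed

section \<open>Following tangles up the tree\<close>

lemma tangle_meets_vsep:
  assumes "tangle star A F \<tau>" "nonleaf V E r v"
  obtains x where "x \<in> vsep v" "x \<in> \<tau>"
  using assms(1) nonleaf_bij(1)[OF assms(2)] unfolding tangle_def orientation_def by blast

text \<open>A subset of the labels in \<open>F\<close> would also be a subset of
  \<open>\<tau>\<close>, so the leaf is not forbidden. Its closure is thus a tangle inside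
  \<open>\<tau>\<close>, hence equal to it.\<close>

lemma leaf_of_tangle:
  assumes "tangle star A F \<tau>" "leaf V E r l" "labels l \<subseteq> \<tau>"
  shows "tangle_leaf star A F V E r \<beta> l" "sep_closure star A (labels l) = \<tau>"
proof -
  have "\<not> forbidden_leaf F V E r \<beta> l"
    using assms unfolding forbidden_leaf_def has_subset_in_def tangle_def by blast
  then show l: "tangle_leaf star A F V E r \<beta> l"
    using structure_tree assms(2) unfolding tangle_structure_tree_def by blast
  then show "sep_closure star A (labels l) = \<tau>"
    using tangle_subset_eq tangle_closure assms unfolding tangle_leaf_def by blast
qed

lemma tangle_leaf_above:
  assumes "tangle star A F \<tau>" "v \<in> V" "labels v \<subseteq> \<tau>"
  obtains l where "tangle_leaf star A F V E r \<beta> l" "tree_le V E r v l"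
proof -
  obtain l where l: "l \<in> V" "tree_le V E r v l" "labels l \<subseteq> \<tau>"
    and deepest: "\<And>u. child V E r l u \<Longrightarrow> \<not> (tree_le V E r v u \<and> labels u \<subseteq> \<tau>)"
    using deepest[OF assms(2), of "\<lambda>w. tree_le V E r v w \<and> labels w \<subseteq> \<tau>"]
      conjI[OF tree_le_refl[OF assms(2)] assms(3)] by metis
  have "leaf V E r l"
  proof (rule ccontr)
    assume "\<not> leaf V E r l"
    then have "nonleaf V E r l" using l(1) by (simp add: nonleaf_def)
    then obtain x where "x \<in> vsep l" "x \<in> \<tau>" using tangle_meets_vsep assms(1) by blast
    then obtain u where u: "child V E r l u" "\<beta> {l, u} \<in> \<tau>" by (metis vsep_child)
    then have "labels u \<subseteq> \<tau>" using path_labels_child[OF u(1), of \<beta>] l(3) by simp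
    then show False
      using deepest[OF u(1)] tree_le_trans[OF l(2) childD(4)[OF u(1)]] by simp
  qed
  then show thesis using that leaf_of_tangle(1)[OF assms(1) _ l(3)] l(2) by simp
qed

lemma vsep_distinguishes_optimally:
  assumes "tangle star A F \<tau>" "tangle star A F \<tau>'" "nonleaf V E r v"
    and "labels v \<subseteq> \<tau>" "labels v \<subseteq> \<tau>'"
    and "x \<in> vsep v" "y \<in> vsep v" "x \<noteq> y" "x \<in> \<tau>" "y \<in> \<tau>'"
  shows "distinguishes_optimally star ord A (vsep v) \<tau> \<tau>'"
proof -
  have "\<not> distinguishes t \<tau> \<tau>'" if t: "t \<in> seps star A" "ord t < ord (vsep v)" for t
  proof
    assume "distinguishes t \<tau> \<tau>'"
    then obtain a b where ab: "a \<in> t" "b \<in> t" "a \<noteq> b" "a \<in> \<tau>" "b \<in> \<tau>'"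
      unfolding distinguishes_def by blast
    \<comment> \<open>The order of \<open>vsep v\<close> is least among the unoriented separations,
      so the closure of the labels orients \<open>t\<close>, and both tangles inherit that
      orientation.\<close>
    have "t \<notin> unoriented_by star A (labels v)"
      using ordered assms(3) t(2) unfolding thoroughly_ordered_def by force
    then obtain c where "c \<in> t" "c \<in> sep_closure star A (labels v)"
      using t(1) unfolding unoriented_by_def by blast
    then have "c \<in> \<tau>" "c \<in> \<tau>'" using tangle_closure assms by blast+
    then show False using tangle_unique[OF _ t(1)] ab \<open>c \<in> t\<close> assms(1,2) by metis
  qed
  then show ?thesis
    using assms(6-) unfolding distinguishes_optimally_def distinguishes_def by blast
qed

text \<open>The node sought is a deepest one whose labels lie in both tangles. A leaf there would
  have both tangles as its closure.\<close>

lemma distinguishing_tangle_node: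
  assumes "tangle star A F \<tau>" "tangle star A F \<tau>'" "\<tau> \<noteq> \<tau>'"
  obtains v where "tangle_node star A F V E r \<beta> v"
    "distinguishes_optimally star ord A (vsep v) \<tau> \<tau>'"
proof -
  have root: "r \<in> V" using rooted_tree by (simp add: rooted_tree_def)
  obtain v where v: "v \<in> V" "labels v \<subseteq> \<tau>" "labels v \<subseteq> \<tau>'"
    and deepest: "\<And>u. child V E r v u \<Longrightarrow> \<not> (labels u \<subseteq> \<tau> \<and> labels u \<subseteq> \<tau>')"
    using deepest[of r "\<lambda>w. labels w \<subseteq> \<tau> \<and> labels w \<subseteq> \<tau>'"] root path_labels_root[of \<beta>]
    by (metis empty_subsetI)
  have nl: "nonleaf V E r v"
    using leaf_of_tangle(2)[OF assms(1) _ v(2)] leaf_of_tangle(2)[OF assms(2) _ v(3)] assms(3) v(1)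
    unfolding nonleaf_def by blast
  obtain x where x: "x \<in> vsep v" "x \<in> \<tau>" using tangle_meets_vsep assms(1) nl by blast
  obtain y where y: "y \<in> vsep v" "y \<in> \<tau>'" using tangle_meets_vsep assms(2) nl by blast
  have "x \<noteq> y"
  proof
    assume "x = y"
    obtain w where w: "child V E r v w" "\<beta> {v, w} = x" using vsep_child x(1) by blast
    then show False
      using deepest[OF w(1)] path_labels_child[OF w(1), of \<beta>] v(2,3) x(2) y(2) \<open>x = y\<close> by simp
  qed
  \<comment> \<open>A separation has at most two orientations, so each child follows
    \<open>\<tau>\<close> or \<open>\<tau>'\<close> and has a tangle leaf above it.\<close>
  have xy: "z = x \<or> z = y" if "z \<in> vsep v" for z
    using nonleaf_bij(1)[OF nl] that x y \<open>x \<noteq> y\<close> by (auto simp: seps_def sep_def)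
  have "\<exists>l. tangle_leaf star A F V E r \<beta> l \<and> tree_le V E r w l" if w: "child V E r v w" for w
  proof -
    have "labels w \<subseteq> \<tau> \<or> labels w \<subseteq> \<tau>'"
      using xy[OF child_vsep[OF w]] path_labels_child[OF w, of \<beta>] v x y by auto
    then show ?thesis
      using tangle_leaf_above childD(2)[OF w] assms(1,2) by metis
  qed
  then have "tangle_node star A F V E r \<beta> v" using nl unfolding tangle_node_def by blast
  moreover have "distinguishes_optimally star ord A (vsep v) \<tau> \<tau>'"
    using vsep_distinguishes_optimally assms(1,2) nl v(2,3) x y \<open>x \<noteq> y\<close> by blast
  ultimately show thesis using that by blast
qed

section \<open>Tangle nodes versus optimal separations\<close>

lemma tangle_node_tangle:
  assumes "tangle_node star A F V E r \<beta> v" "x \<in> vsep v"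
  obtains \<tau> where "tangle star A F \<tau>" "labels v \<subseteq> \<tau>" "x \<in> \<tau>"
proof -
  obtain w where w: "child V E r v w" "\<beta> {v, w} = x" using assms(2) vsep_child by blast
  then obtain l where l: "tangle_leaf star A F V E r \<beta> l" "tree_le V E r w l"
    using assms(1) unfolding tangle_node_def by blast
  have "insert x (labels v) \<subseteq> sep_closure star A (labels l)"
    using path_labels_mono[OF l(2), of \<beta>] path_labels_child[OF w(1), of \<beta>] w(2)
    unfolding sep_closure_def by auto
  then show thesis using that l(1) unfolding tangle_leaf_def by blast
qed

text \<open>The tangle leaves above the two children supply tangles that share the labels of
  \<open>v\<close> and differ on \<open>vsep v\<close>. Nondegeneracy makes the two orientations
  distinct.\<close>

lemma tangle_node_optimal:
  assumes "tangle_node star A F V E r \<beta> v" "\<forall>x\<in>vsep v. \<not> degenerate star x"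
  shows "optimal (vsep v)"
proof -
  have nl: "nonleaf V E r v" using assms(1) by (simp add: tangle_node_def)
  obtain x where x: "x \<in> A" "vsep v = {x, star x}"
    using nonleaf_bij(1)[OF nl] unfolding seps_def sep_def by auto
  obtain \<tau> where "tangle star A F \<tau>" "labels v \<subseteq> \<tau>" "x \<in> \<tau>"
    using tangle_node_tangle[OF assms(1), of x] x(2) by (metis insertI1)
  moreover obtain \<tau>' where "tangle star A F \<tau>'" "labels v \<subseteq> \<tau>'" "star x \<in> \<tau>'"
    using tangle_node_tangle[OF assms(1), of "star x"] x(2) by (metis insertI1 insertI2)
  moreover have "x \<noteq> star x" using assms(2) x by (simp add: degenerate_def)
  ultimately show ?thesis
    using vsep_distinguishes_optimally[of \<tau> \<tau>' v x "star x"] nl x(2) nonleaf_bij(1)[OF nl]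
    unfolding optimal_def by blast
qed

text \<open>Some tangle node separation distinguishes the same two tangles optimally. Neither order
  can be smaller, and injectivity identifies the separations.\<close>

lemma optimal_tangle_node:
  assumes "optimal s"
  obtains v where "tangle_node star A F V E r \<beta> v" "s = vsep v"
proof -
  obtain x \<tau> \<tau>' where \<tau>: "tangle star A F \<tau>" "tangle star A F \<tau>'"
    and opt: "distinguishes_optimally star ord A s \<tau> \<tau>'"
    and x: "s = sep star x" "x \<in> \<tau>" "star x \<in> \<tau>'" "x \<in> A" "x \<noteq> star x"
    using assms by (rule optimalE)
  have "\<tau> \<noteq> \<tau>'" using tangle_star[OF \<tau>(1)] x by metis
  then obtain v where v: "tangle_node star A F V E r \<beta> v"
    "distinguishes_optimally star ord A (vsep v) \<tau> \<tau>'"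
    using distinguishing_tangle_node \<tau> by blast
  then have vs: "vsep v \<in> seps star A" using nonleaf_bij(1) by (simp add: tangle_node_def)
  moreover have "s \<in> seps star A" using assms by (simp add: optimal_def)
  ultimately have "ord s = ord (vsep v)"
    using opt v(2) unfolding distinguishes_optimally_def by (meson linorder_neqE)
  then have "s = vsep v"
    using ord_inj vs x(1) unfolding inj_on_def seps_def by blast
  then show thesis using that v(1) by blast
qed

text \<open>A degenerate separation distinguishes no tangles, so nestedness of optimal separations
  does not cover it. The tangles containing \<open>y\<close> and \<open>star y\<close> come from the
  children of \<open>w\<close>.\<close>

lemma nested_degenerate_tangle_node:
  assumes v: "tangle_node star A F V E r \<beta> v" "x \<in> vsep v" "degenerate star x"
    and w: "tangle_node star A F V E r \<beta> w"
  shows "nested (vsep v) (vsep w)"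
proof -
  have "vsep v \<in> seps star A" "vsep w \<in> seps star A"
    using nonleaf_bij(1) v(1) w by (simp_all add: tangle_node_def)
  then obtain z y where z: "z \<in> A" "vsep v = {z, star z}" and y: "y \<in> A" "vsep w = {y, star y}"
    unfolding seps_def sep_def by auto
  have sz: "star z = z" using v(2,3) z(2) unfolding degenerate_def
    by (metis insertE singletonD star_star)
  obtain \<tau> where \<tau>: "tangle star A F \<tau>" "y \<in> \<tau>"
    using tangle_node_tangle[OF w, of y] y(2) by (metis insertI1)
  obtain \<tau>' where \<tau>': "tangle star A F \<tau>'" "star y \<in> \<tau>'"
    using tangle_node_tangle[OF w, of "star y"] y(2) by (metis insertI1 insertI2)
  show ?thesis using nested_degenerate[OF sz z(1) y(1) \<tau> \<tau>'] y(2) z(2) by (simp add: sep_def)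
qed

lemma nested_tangle_nodes:
  assumes "tangle_node star A F V E r \<beta> v" "tangle_node star A F V E r \<beta> w"
  shows "nested (vsep v) (vsep w)"
proof -
  consider x where "x \<in> vsep v" "degenerate star x" | x where "x \<in> vsep w" "degenerate star x"
    | "\<forall>x\<in>vsep v. \<not> degenerate star x" "\<forall>x\<in>vsep w. \<not> degenerate star x"
    by blast
  then show ?thesis
  proof cases
    case 1
    then show ?thesis using nested_degenerate_tangle_node[OF assms(1) _ _ assms(2)] by simp
  next
    case 2
    then have "nested (vsep w) (vsep v)"
      using nested_degenerate_tangle_node[OF assms(2) _ _ assms(1)] by simp
    then show ?thesis using nested_commute by blast
  next
    case 3
    then show ?thesis using nested_optimal tangle_node_optimal assms by simp
  qed
qed

lemma tree_of_tangles_tangle_node_seps: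
  "tree_of_tangles star ord A F (tangle_node_seps star A F V E r \<beta>)"
proof -
  have "vsep v \<in> seps star A" if "tangle_node star A F V E r \<beta> v" for v
    using that nonleaf_bij(1) by (simp add: tangle_node_def)
  then show ?thesis
    unfolding tree_of_tangles_def nested_set_def tangle_node_seps_def
    using nested_tangle_nodes distinguishing_tangle_node by (auto; metis)
qed

text \<open>A tangle node may carry a degenerate separation, which distinguishes nothing; hence the
  restriction on the left.\<close>

lemma nondegenerate_tangle_node_seps:
  "{s \<in> tangle_node_seps star A F V E r \<beta>. \<forall>x\<in>s. \<not> degenerate star x} = {s. optimal s}"
proof (intro equalityI subsetI)
  fix s assume "s \<in> {s \<in> tangle_node_seps star A F V E r \<beta>. \<forall>x\<in>s. \<not> degenerate star x}"
  then show "s \<in> {s. optimal s}" using tangle_node_optimal unfolding tangle_node_seps_def by auto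
next
  fix s assume s: "s \<in> {s. optimal s}"
  then obtain v where "tangle_node star A F V E r \<beta> v" "s = vsep v"
    using optimal_tangle_node by blast
  moreover obtain x where "s = {x, star x}" "x \<noteq> star x"
    using s optimalE unfolding sep_def by (metis mem_Collect_eq)
  ultimately show "s \<in> {s \<in> tangle_node_seps star A F V E r \<beta>. \<forall>x\<in>s. \<not> degenerate star x}"
    unfolding tangle_node_seps_def degenerate_def by auto
qed

end

theorem theorem6p2:
  fixes star :: "'a::{finite, lattice} \<Rightarrow> 'a"
    and ord :: "'a set \<Rightarrow> real"
    and k :: real
    and F :: "'a set set"
    and V :: "'v set" and E :: "'v set set" and r :: 'v and \<beta> :: "'v set \<Rightarrow> 'a"
  defines "A \<equiv> below star ord k"
  defines "N \<equiv> tangle_node_seps star A F V E r \<beta>"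
  assumes "universe star"
    and "inj_on ord (seps star UNIV)"
    and "structurally_submodular star ord"
    and "rich star ord A F"
    and "standard star A F"
    and "robust_sets star ord \<subseteq> F"
    and "tangle_structure_tree star A F V E r \<beta>"
    and "thoroughly_ordered star ord A V E r \<beta>"
  shows "tree_of_tangles star ord A F N \<and>
    {s \<in> N. \<forall>x\<in>s. \<not> degenerate star x} =
      {s \<in> seps star A. \<exists>\<tau> \<tau>'. tangle star A F \<tau> \<and> tangle star A F \<tau>' \<and>
         distinguishes_optimally star ord A s \<tau> \<tau>'}"
proof -
  have "rooted_tree V E r"
    using assms(9) unfolding tangle_structure_tree_def separation_tree_def by blast
  then interpret ordered_structure_tree star ord k F V E r \<beta>
    using assms(3-5,8-10) unfolding A_def by unfold_locales
  show ?thesis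
    using tree_of_tangles_tangle_node_seps nondegenerate_tangle_node_seps
    unfolding N_def A_def optimal_def by simp
qed

end
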